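(* Let $a$ be an integer and let $n$ be a positive odd integer. Then, for an indeterminate $q$ (equivalently, for every complex number $q\neq 0,1$), $$\det\left[\left[\left\lceil\frac{(a+1)j-ak}{n}\right\rceil\right]_q\right]_{1\leqslant j,k\leqslant n}=\left(\frac{a(a+1)}{n}\right)q^{(n-1)/2}.$$
   Context: For an integer $m$, its $q$-analogue is $[m]_q=(1-q^m)/(1-q)$. $\lceil x\rceil$ denotes the least integer not smaller than $x$. $\left(\frac{\cdot}{n}\right)$ denotes the Jacobi symbol modulo the positive odd integer $n$ (equal to $0$ when the argument is not coprime to $n$, and $\left(\frac{\cdot}{1}\right)=1$). *)

theory Defs
  imports Complex_Main "HOL-Number_Theory.Number_Theory" "Jordan_Normal_Form.Determinant"
begin

definition qint :: "complex \<Rightarrow> int \<Rightarrow> complex" where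
  "qint q m = (1 - q powi m) / (1 - q)"

definition Jacobi :: "int \<Rightarrow> nat \<Rightarrow> int" where
  "Jacobi a n = (\<Prod>p\<in>prime_factors n. Legendre a (int p) ^ multiplicity p n)"

end

theory Submission
  imports Defs
begin

text \<open>
  Let b = a + 1 and suppose first that a and b are coprime to n. Reducing b j and a k modulo n
  to representatives in 1..n permutes the rows and the columns, by Zolotarev's lemma with signs
  given by the Jacobi symbols of b and a. Up to these permutations and to scaling rows and
  columns by powers of q, the matrix with entries 1 - q powi C (C the ceiling) becomes a rank-one
  matrix minus the matrix N with entry q below the diagonal and 1 elsewhere. Consecutive rows of N
  differ by q - 1 times a unit vector, so N has an explicit inverse and the determinant reduces
  to a single sum; pairing the solutions of a x = b y modulo n with those of a x + 1 = b y shows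
  that this sum is 1 - 1/q.

  If a or b shares a factor with n, then at least three columns or rows are affine images of one
  vector, hence dependent, and both sides vanish.

  Zolotarev's lemma for odd n follows from the prime case (a primitive root acts as a cycle of
  even length) since x = r + m y splits multiplication modulo m n into multiplication modulo m
  and affine maps modulo n, and translations modulo an odd number are even.
\<close>

subsection \<open>Zolotarev's lemma\<close>

text \<open>Transport along an injection turns each transposition into a transposition, nontrivial
  exactly when the original is.\<close>

lemma sign_map_permutation:
  assumes "finite A" "inj_on f A" "p permutes A"
  shows "sign (map_permutation A f p) = sign p"
  using assms(3,1)
proof (induction rule: permutes_induct)
  case id
  then show ?case using map_permutation_id'[OF assms(2)] by (metis sign_id)
next
  case (swap x y p)
  have perm: "map_permutation A f p permutes f ` A"
    by (rule map_permutation_permutes) (use swap assms in \<open>auto simp: bij_betw_def\<close>)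
  have "map_permutation A f (transpose x y \<circ> p)
      = transpose (f x) (f y) \<circ> map_permutation A f p"
    by (subst map_permutation_compose')
       (use swap assms in \<open>auto simp: map_permutation_transpose permutes_swap_id\<close>)
  moreover have "f x = f y \<longleftrightarrow> x = y"
    using swap assms(2) by (auto simp: inj_on_def)
  moreover have "permutation p" "permutation (map_permutation A f p)"
    using swap assms(1) perm permutation_permutes by blast+
  ultimately show ?case
    using swap by (simp only: sign_compose permutation_swap_id sign_swap_id simp_thms if_cancel)
qed

text \<open>\<open>F\<close> is a product of copies of the \<open>\<sigma> i\<close> with disjoint
  supports, one on the image of \<open>A\<close> under each \<open>f i\<close>.\<close>

lemma sign_fibrewise:
  assumes "finite I" "finite A"
    and "\<And>i j x y. i \<in> I \<Longrightarrow> j \<in> I \<Longrightarrow> x \<in> A \<Longrightarrow> y \<in> A \<Longrightarrow> f i x = f j y \<Longrightarrow> i = j \<and> x = y"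
    and "\<And>i. i \<in> I \<Longrightarrow> \<sigma> i permutes A"
    and "\<And>i x. i \<in> I \<Longrightarrow> x \<in> A \<Longrightarrow> F (f i x) = f i (\<sigma> i x)"
    and "\<And>y. (\<And>i x. i \<in> I \<Longrightarrow> x \<in> A \<Longrightarrow> y \<noteq> f i x) \<Longrightarrow> F y = y"
  shows "permutation F \<and> sign F = (\<Prod>i\<in>I. sign (\<sigma> i))"
  using assms(1,3-6)
proof (induction I arbitrary: F rule: finite_induct)
  case empty
  then have "F = id" by auto
  then show ?case by simp
next
  case (insert i I)
  \<comment> \<open>With the fibre over \<open>i\<close> frozen, \<open>G\<close> meets the
    hypotheses for \<open>I\<close>; \<open>P\<close> restores the action on that fibre.\<close>
  define G where "G = (\<lambda>y. if y \<in> f i ` A then y else F y)"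
  define P where "P = map_permutation A (f i) (\<sigma> i)"
  have inj: "inj_on (f i) A"
    using insert.prems(1)[of i i] by (intro inj_onI) blast
  have disj: "f j x \<notin> f i ` A" if "j \<in> I" "x \<in> A" for j x
    using insert.prems(1)[of j i x] insert.hyps(2) that by blast
  have P: "P permutes f i ` A"
    unfolding P_def
    by (rule map_permutation_permutes) (use inj insert.prems(2) in \<open>auto simp: bij_betw_def\<close>)
  have G: "permutation G \<and> sign G = (\<Prod>i\<in>I. sign (\<sigma> i))"
  proof (rule insert.IH)
    show "i' = j \<and> x = y" if "i' \<in> I" "j \<in> I" "x \<in> A" "y \<in> A" "f i' x = f j y" for i' j x y
      using insert.prems(1)[of i' j x y] that by blast
    show "\<sigma> j permutes A" if "j \<in> I" for j using insert.prems that by auto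
    show "G (f j x) = f j (\<sigma> j x)" if "j \<in> I" "x \<in> A" for j x
      using disj[OF that] insert.prems(3) that by (simp add: G_def)
    show "G y = y" if "\<And>j x. j \<in> I \<Longrightarrow> x \<in> A \<Longrightarrow> y \<noteq> f j x" for y
      using that insert.prems(4)[of y] by (cases "y \<in> f i ` A") (auto simp: G_def)
  qed
  have "F = P \<circ> G"
  proof
    fix y
    consider x where "x \<in> A" "y = f i x" | j x where "j \<in> I" "x \<in> A" "y = f j x"
      | "\<And>j x. j \<in> insert i I \<Longrightarrow> x \<in> A \<Longrightarrow> y \<noteq> f j x"
      by blast
    then show "F y = (P \<circ> G) y"
    proof cases
      case 1
      then show ?thesis
        using insert.prems(3) inj by (simp add: G_def P_def map_permutation_apply)
    next
      case 2
      have "\<sigma> j x \<in> A" using 2 insert.prems(2) by (simp add: permutes_in_image)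
      then show ?thesis
        using 2 disj[OF 2(1,2)] disj[of j "\<sigma> j x"] P insert.prems(3)
        by (simp add: G_def permutes_not_in)
    next
      case 3
      then have "y \<notin> f i ` A" and "F y = y" using insert.prems(4)[of y] by blast+
      then show ?thesis using P by (simp add: G_def permutes_not_in)
    qed
  qed
  moreover have "permutation P" using P assms(2) permutation_permutes by blast
  moreover have "sign P = sign (\<sigma> i)"
    unfolding P_def using sign_map_permutation[OF assms(2) inj] insert.prems(2) by simp
  ultimately show ?case
    using G insert.hyps sign_compose[of P G] permutation_compose[of P G] 
    by (metis prod.insert)
qed

section \<open>Affine maps modulo n and their signs\<close>

text \<open>All numbers from \<open>n\<close> on are fixed so that, for \<open>a\<close> coprime to
  \<open>n\<close>, the map on all naturals permutes \<open>{0..<n}\<close> and has a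
  \<open>sign\<close>.\<close>

definition affine_mod :: "nat \<Rightarrow> int \<Rightarrow> int \<Rightarrow> nat \<Rightarrow> nat" where
  "affine_mod n a c x = (if x < n then nat ((a * int x + c) mod int n) else x)"

lemma int_affine_mod: "x < n \<Longrightarrow> int (affine_mod n a c x) = (a * int x + c) mod int n"
  by (simp add: affine_mod_def)

lemma affine_mod_less [simp]: "x < n \<Longrightarrow> affine_mod n a c x < n"
  by (simp add: affine_mod_def nat_less_iff)

lemma affine_mod_cong:
  assumes "[a = a'] (mod int n)" "[c = c'] (mod int n)"
  shows "affine_mod n a c = affine_mod n a' c'"
proof
  fix x
  have "[a * int x + c = a' * int x + c'] (mod int n)"
    using assms by (intro cong_add cong_mult) auto
  then show "affine_mod n a c x = affine_mod n a' c' x" by (simp add: affine_mod_def cong_def)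
qed

lemma affine_mod_comp: "affine_mod n a c \<circ> affine_mod n a' c' = affine_mod n (a * a') (a * c' + c)"
proof
  fix x
  show "(affine_mod n a c \<circ> affine_mod n a' c') x = affine_mod n (a * a') (a * c' + c) x"
  proof (cases "x < n")
    case True
    have "[a * ((a' * int x + c') mod int n) + c = a * (a' * int x + c') + c] (mod int n)"
      by (intro cong_add cong_mult) auto
    then have "int ((affine_mod n a c \<circ> affine_mod n a' c') x)
        = int (affine_mod n (a * a') (a * c' + c) x)"
      using True by (simp add: int_affine_mod cong_def algebra_simps)
    then show ?thesis by simp
  qed (simp add: affine_mod_def)
qed

lemma affine_mod_permutes:
  assumes "coprime a (int n)"
  shows "affine_mod n a c permutes {0..<n}"
proof (rule bij_imp_permutes)
  have "inj_on (affine_mod n a c) {0..<n}"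
  proof
    fix x y assume xy: "x \<in> {0..<n}" "y \<in> {0..<n}" "affine_mod n a c x = affine_mod n a c y"
    then have "[a * int x + c = a * int y + c] (mod int n)"
      using int_affine_mod[of x n a c] int_affine_mod[of y n a c] by (simp add: cong_def)
    then have "[int x = int y] (mod int n)"
      using assms by (simp add: cong_add_rcancel cong_mult_lcancel)
    then show "x = y" using xy by (simp add: cong_def)
  qed
  moreover have "affine_mod n a c ` {0..<n} \<subseteq> {0..<n}" by auto
  ultimately show "bij_betw (affine_mod n a c) {0..<n} {0..<n}"
    by (simp add: bij_betw_def endo_inj_surj)
qed (simp add: affine_mod_def)

lemma permutation_affine_mod: "coprime a (int n) \<Longrightarrow> permutation (affine_mod n a c)"
  using affine_mod_permutes permutation_permutes by blast

text \<open>The shift is an n-cycle; one more transposition inserts the point n between n - 1 and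
  0.\<close>

lemma sign_shift:
  assumes "n > 0"
  shows "sign (affine_mod n 1 1) = (-1) ^ (n - 1)"
  using assms
proof (induction n rule: nat_induct_non_zero)
  case 1
  have "affine_mod 1 1 1 = id" by (auto simp: affine_mod_def fun_eq_iff)
  then show ?case by simp
next
  case (Suc n)
  have "affine_mod (Suc n) 1 1 = transpose 0 n \<circ> affine_mod n 1 1"
  proof
    fix x
    consider "x < n - 1" | "x = n - 1" | "x = n" | "x > n" by linarith
    then show "affine_mod (Suc n) 1 1 x = (transpose 0 n \<circ> affine_mod n 1 1) x"
      using Suc.hyps
      by cases (auto simp: affine_mod_def transpose_def nat_add_distrib of_nat_diff nat_eq_iff add.commute)
  qed
  then have "sign (affine_mod (Suc n) 1 1) = sign (transpose 0 n) * sign (affine_mod n 1 1)"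
    using sign_compose[OF permutation_swap_id permutation_affine_mod[of 1 n 1]] by simp
  then show ?case
    using Suc by (cases n) (auto simp: sign_swap_id)
qed

text \<open>Translations are powers of the shift, which for odd \<open>n\<close> is a cycle of odd
  length, hence even.\<close>

lemma sign_translation:
  assumes "odd n"
  shows "sign (affine_mod n 1 c) = 1"
proof -
  have nat: "sign (affine_mod n 1 (int k)) = 1" for k
  proof (induction k)
    case 0
    have "affine_mod n 1 0 = id" by (auto simp: affine_mod_def fun_eq_iff)
    then show ?case by simp
  next
    case (Suc k)
    have "affine_mod n 1 (int (Suc k)) = affine_mod n 1 1 \<circ> affine_mod n 1 (int k)"
      by (simp add: affine_mod_comp add.commute)
    moreover have "sign (affine_mod n 1 1) = 1"
      using assms by (subst sign_shift) (auto elim: oddE)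
    moreover have "sign (affine_mod n 1 1 \<circ> affine_mod n 1 (int k))
        = sign (affine_mod n 1 1) * sign (affine_mod n 1 (int k))"
      by (intro sign_compose permutation_affine_mod) auto
    ultimately show ?case using Suc by presburger
  qed
  have "affine_mod n 1 c = affine_mod n 1 (int (nat (c mod int n)))"
    by (rule affine_mod_cong) (use assms in \<open>auto simp: cong_def odd_pos\<close>)
  then show ?thesis using nat by metis
qed

lemma sign_affine_mod:
  assumes "odd n" "coprime a (int n)"
  shows "sign (affine_mod n a c) = sign (affine_mod n a 0)"
proof -
  have "affine_mod n a c = affine_mod n 1 c \<circ> affine_mod n a 0" by (simp add: affine_mod_comp)
  moreover have "sign (affine_mod n 1 c \<circ> affine_mod n a 0)
      = sign (affine_mod n 1 c) * sign (affine_mod n a 0)"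
    using assms by (intro sign_compose permutation_affine_mod) auto
  ultimately show ?thesis using assms by (simp add: sign_translation)
qed

lemma sign_affine_mod_mult:
  assumes "coprime a (int n)" "coprime b (int n)"
  shows "sign (affine_mod n (a * b) 0) = sign (affine_mod n a 0) * sign (affine_mod n b 0)"
  using sign_compose[OF permutation_affine_mod[OF assms(1)] permutation_affine_mod[OF assms(2)],
      of 0 0]
  by (simp only: affine_mod_comp) simp

text \<open>For x = r + m y, the low digit of a x is a r mod m and the high digit is a y plus the
  carry a r div m, modulo n. The two digit maps act on m and n fibres respectively, and these odd
  exponents do not change a sign.\<close>

lemma sign_affine_mod_modulus_mult:
  assumes "odd m" "odd n" "coprime a (int m)" "coprime a (int n)"
  shows "sign (affine_mod (m * n) a 0) = sign (affine_mod m a 0) * sign (affine_mod n a 0)"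
proof -
  have pos: "m > 0" "n > 0" using assms by (auto intro: odd_pos)
  \<comment> \<open>\<open>F\<close> changes only the high digit and takes the carry from the
    original low digit, so it acts before \<open>G\<close>, which changes only the low
    digit.\<close>
  define F where "F = (\<lambda>x. if x < m * n
    then x mod m + m * affine_mod n a (a * int (x mod m) div int m) (x div m) else x)"
  define G where "G = (\<lambda>x. if x < m * n then affine_mod m a 0 (x mod m) + m * (x div m) else x)"
  have lt: "r + m * y < m * n" if "r < m" "y < n" for r y
  proof -
    have "r + m * y < m * Suc y" using that by simp
    also have "\<dots> \<le> m * n" using that by (intro mult_le_mono) auto
    finally show ?thesis .
  qed
  have div_lt: "x div m < n" if "x < m * n" for x
    using that by (simp add: less_mult_imp_div_less mult.commute)
  have decomp: "y mod m < m \<and> y div m < n \<and> y = y mod m + m * (y div m)" if "y < m * n" for y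
    using pos div_lt[OF that] by simp
  have inj: "r = r' \<and> y = y'" if "r < m" "r' < m" "r + m * y = r' + m * y'" for r r' y y'
  proof -
    have "(r + m * y) mod m = (r' + m * y') mod m" "(r + m * y) div m = (r' + m * y') div m"
      using that by simp_all
    then show ?thesis using that(1,2) by simp
  qed
  have F: "permutation F \<and> sign F = (\<Prod>r\<in>{0..<m}. sign (affine_mod n a (a * int r div int m)))"
  proof (rule sign_fibrewise[where A = "{0..<n}" and f = "\<lambda>r y. r + m * y"])
    show "F y = y" if "\<And>r x. r \<in> {0..<m} \<Longrightarrow> x \<in> {0..<n} \<Longrightarrow> y \<noteq> r + m * x" for y
      using that[of "y mod m" "y div m"] decomp[of y] unfolding F_def by auto
    show "r = r' \<and> x = y" if "r \<in> {0..<m}" "r' \<in> {0..<m}" "r + m * x = r' + m * y" for r r' x y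
      using inj[of r r' x y] that by simp
  qed (use assms lt in \<open>auto simp: F_def affine_mod_permutes\<close>)
  have G: "permutation G \<and> sign G = (\<Prod>y\<in>{0..<n}. sign (affine_mod m a 0))"
  proof (rule sign_fibrewise[where A = "{0..<m}" and f = "\<lambda>y r. r + m * y"])
    show "G y = y" if "\<And>x r. x \<in> {0..<n} \<Longrightarrow> r \<in> {0..<m} \<Longrightarrow> y \<noteq> r + m * x" for y
      using that[of "y div m" "y mod m"] decomp[of y] unfolding G_def by auto
    show "x = y \<and> r = r'" if "r \<in> {0..<m}" "r' \<in> {0..<m}" "r + m * x = r' + m * y" for r r' x y
      using inj[of r r' x y] that by simp
  qed (use assms lt in \<open>auto simp: G_def affine_mod_permutes\<close>)
  have "affine_mod (m * n) a 0 = G \<circ> F"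
  proof
    fix x
    show "affine_mod (m * n) a 0 x = (G \<circ> F) x"
    proof (cases "x < m * n")
      case True
      define r y where "r = x mod m" and "y = x div m"
      have r: "r < m" and y: "y < n" and x: "x = r + m * y"
        using pos div_lt[OF True] by (auto simp: r_def y_def)
      have "int (affine_mod (m * n) a 0 x) = (a * int x) mod (int m * int n)"
        using True by (simp add: int_affine_mod)
      also have "\<dots> = int m * ((a * int x) div int m mod int n) + (a * int x) mod int m"
        by (rule zmod_zmult2_eq) simp
      also have "a * int x = a * int r + (a * int y) * int m"
        by (simp add: x algebra_simps)
      also have "(\<dots>) div int m = a * int y + a * int r div int m"
        using pos by (subst div_mult_self1) auto
      also have "(a * int r + (a * int y) * int m) mod int m = (a * int r) mod int m"
        by simp
      finally have "int (affine_mod (m * n) a 0 x)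
          = int (affine_mod m a 0 r + m * affine_mod n a (a * int r div int m) y)"
        using r y by (simp add: int_affine_mod)
      moreover have "F x = r + m * affine_mod n a (a * int r div int m) y"
        using True by (simp add: F_def r_def y_def)
      moreover have "G (F x) = affine_mod m a 0 r + m * affine_mod n a (a * int r div int m) y"
        using lt[of r "affine_mod n a (a * int r div int m) y"] r y calculation(2) by (simp add: G_def)
      ultimately show ?thesis unfolding o_def of_nat_eq_iff by simp
    qed (simp add: affine_mod_def F_def G_def)
  qed
  then have "sign (affine_mod (m * n) a 0) = sign G * sign F"
    using F G sign_compose by metis
  moreover have "sign s ^ k = sign s" if "odd k" for k and s :: "nat \<Rightarrow> nat"
    using that by (cases s rule: sign_cases) auto
  moreover have "sign F = sign (affine_mod n a 0) ^ m"
  proof -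
    \<comment> \<open>The carry depends on the fibre, but it is only a translation and does not
      affect the sign.\<close>
    have "sign F = (\<Prod>r\<in>{0..<m}. sign (affine_mod n a 0))"
      unfolding F[THEN conjunct2] by (intro prod.cong refl sign_affine_mod assms)
    then show ?thesis by simp
  qed
  moreover have "sign G = sign (affine_mod m a 0) ^ n"
    using G by simp
  ultimately show ?thesis
    using assms(1,2) by simp
qed

section \<open>Prime moduli\<close>

text \<open>Listing the nonzero residues as powers of \<open>g\<close> turns multiplication by
  \<open>g\<close> into the shift of exponents modulo p - 1, a cycle of even length.\<close>

lemma sign_affine_mod_primroot:
  assumes "prime p" "odd p" "residue_primroot p g"
  shows "sign (affine_mod p (int g) 0) = -1"
proof -
  have p: "p > 2" using assms prime_gt_1_nat[of p] by (cases "p = 2") auto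
  have bij: "bij_betw (\<lambda>i. g ^ i mod p) {..<totient p} (totatives p)"
    using residue_primroot_is_generator[of p g] p assms(3) by simp
  have tot: "totient p = p - 1" using assms(1) by (simp add: totient_prime)
  have img: "(\<lambda>i. g ^ i mod p) ` {0..<p-1} = {0<..<p}"
    using bij totatives_prime[OF assms(1)] by (simp add: bij_betw_def tot atLeast0LessThan)
  have cop: "coprime (int g) (int p)"
    using assms(3) by (auto simp: residue_primroot_def coprime_commute)
  \<comment> \<open>There is a single fibre, the nonzero residues; 0 and the numbers from
    \<open>p\<close> on are fixed.\<close>
  have "permutation (affine_mod p (int g) 0) \<and>
      sign (affine_mod p (int g) 0) = (\<Prod>u\<in>{()}. sign (affine_mod (p - 1) 1 1))"
  proof (rule sign_fibrewise[where A = "{0..<p-1}" and f = "\<lambda>_ i. g ^ i mod p"])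
    show "u = v \<and> i = j" if "i \<in> {0..<p-1}" "j \<in> {0..<p-1}" "g ^ i mod p = g ^ j mod p"
      for u v :: unit and i j
      using bij_betw_imp_inj_on[OF bij, THEN inj_onD, of i j] that by (simp add: tot)
    show "affine_mod p (int g) 0 (g ^ i mod p) = g ^ affine_mod (p - 1) 1 1 i mod p"
      if "i \<in> {0..<p-1}" for i
    proof -
      have "int (affine_mod p (int g) 0 (g ^ i mod p)) = int (g ^ Suc i mod p)"
        using p by (simp add: int_affine_mod zmod_int mod_mult_right_eq)
      moreover have "g ^ affine_mod (p - 1) 1 1 i mod p = g ^ Suc i mod p"
      proof (cases "Suc i < p - 1")
        case True
        then show ?thesis by (simp add: affine_mod_def nat_add_distrib of_nat_diff nat_eq_iff)
      next
        case False
        \<comment> \<open>The last exponent p - 2 goes to 0, which is correct because g^(p-1) = 1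
          modulo p.\<close>
        then have i: "Suc i = p - 1" using that by auto
        then have "affine_mod (p - 1) 1 1 i = 0"
        proof -
          have "1 * int i + 1 = int (p - 1)" unfolding i[symmetric] by simp
          then have "(1 * int i + 1) mod int (p - 1) = 0" by (metis mod_self)
          then show ?thesis unfolding affine_mod_def using that by simp
        qed
        moreover have "[g ^ (p - 1) = 1] (mod p)"
          using euler_theorem[of g p] cop by (simp add: tot coprime_int_iff)
        ultimately show ?thesis using i by (simp add: cong_def)
      qed
      ultimately show ?thesis by simp
    qed
    show "affine_mod p (int g) 0 y = y"
      if "\<And>u i. u \<in> {()} \<Longrightarrow> i \<in> {0..<p-1} \<Longrightarrow> y \<noteq> g ^ i mod p" for y
    proof -
      have "y \<notin> {0<..<p}" using that unfolding img[symmetric] by blast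
      then have "y = 0 \<or> y \<ge> p" by auto
      then show ?thesis using p by (auto simp: affine_mod_def)
    qed
  qed (auto simp: affine_mod_permutes)
  then show ?thesis using p sign_shift[of "p - 1"] assms(2) by simp
qed

text \<open>Along the powers of a primitive root the sign alternates. A square has sign 1 by
  multiplicativity, and a nonresidue must be an odd power.\<close>

lemma sign_affine_mod_prime:
  assumes "prime p" "odd p" "coprime a (int p)"
  shows "sign (affine_mod p a 0) = Legendre a (int p)"
proof -
  have p: "p > 2" using assms prime_gt_1_nat[of p] by (cases "p = 2") auto
  obtain g where g: "residue_primroot p g"
    using prime_primitive_root_exists[of p] assms(1) p by auto
  have cop: "coprime (int g) (int p)"
    using g by (auto simp: residue_primroot_def coprime_commute)
  have pow: "sign (affine_mod p (int g ^ i) 0) = (-1) ^ i" for i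
  proof (induction i)
    case 0
    have "affine_mod p 1 0 = id" by (auto simp: affine_mod_def fun_eq_iff)
    then show ?case by simp
  next
    case (Suc i)
    then show ?case
      using sign_affine_mod_mult[of "int g" p "int g ^ i"] sign_affine_mod_primroot[OF assms(1,2) g] cop
      by simp
  qed
  have not0: "\<not> [a = 0] (mod int p)"
    using assms p coprime_absorb_right[of "int p" a] by (auto simp: cong_0_iff coprime_commute)
  show ?thesis
  proof (cases "QuadRes (int p) a")
    case True
    then obtain x where x: "[x\<^sup>2 = a] (mod int p)" by (auto simp: QuadRes_def)
    then have "coprime (x\<^sup>2) (int p)"
      using assms(3) cong_imp_coprime[OF cong_sym[OF x]] by simp
    then have "coprime x (int p)" by simp
    then have "sign (affine_mod p (x * x) 0) = 1" by (simp add: sign_affine_mod_mult)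
    moreover have "affine_mod p (x * x) 0 = affine_mod p a 0"
      by (rule affine_mod_cong) (use x in \<open>auto simp: power2_eq_square\<close>)
    ultimately show ?thesis using True not0 by (simp add: Legendre_def)
  next
    case False
    have "nat (a mod int p) \<in> totatives p"
    proof -
      have "0 \<le> a mod int p" "a mod int p < int p" "a mod int p \<noteq> 0"
        using p not0 by (auto simp: cong_def)
      then show ?thesis using assms(1) by (simp add: totatives_prime nat_less_iff)
    qed
    then obtain i where "nat (a mod int p) = g ^ i mod p"
      using residue_primroot_is_generator[of p g] p g unfolding bij_betw_def by fastforce
    then have i: "[int g ^ i = a] (mod int p)"
      using p by (simp add: cong_def nat_eq_iff zmod_int)
    have "odd i"
    proof
      assume "even i"
      then have "(int g ^ (i div 2))\<^sup>2 = int g ^ i" by (simp flip: power_mult)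
      then show False using i False by (metis QuadRes_def)
    qed
    moreover have "affine_mod p (int g ^ i) 0 = affine_mod p a 0" by (rule affine_mod_cong) (use i in auto)
    ultimately show ?thesis using pow[of i] False not0 by (simp add: Legendre_def)
  qed
qed

section \<open>The Jacobi symbol and general odd moduli\<close>

lemma Jacobi_prime_mult:
  assumes "prime p" "n > 0"
  shows "Jacobi a (p * n) = Legendre a (int p) * Jacobi a n"
proof -
  \<comment> \<open>Over the multiset of prime factors, exponents become repetitions and products of
    moduli become sums of multisets.\<close>
  have *: "Jacobi a m = (\<Prod>q\<in>#prime_factorization m. Legendre a (int q))" for m
    unfolding Jacobi_def image_prod_mset_multiplicity
    by (intro prod.cong refl) (auto simp: count_prime_factorization prime_factors_dvd)
  show ?thesis
    using assms by (simp add: * prime_factorization_mult prime_factorization_prime)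
qed

text \<open>Both sides are multiplicative over the prime factors of \<open>n\<close>, and
  \<open>c\<close> only composes with an even translation.\<close>

theorem zolotarev:
  assumes "odd n" "coprime a (int n)"
  shows "sign (affine_mod n a c) = Jacobi a n"
proof -
  have "sign (affine_mod n a 0) = Jacobi a n"
    using assms
  proof (induction n rule: prime_divisors_induct)
    case zero
    then show ?case by simp
  next
    case (unit n)
    have "affine_mod 1 a 0 = id" by (auto simp: affine_mod_def fun_eq_iff)
    then show ?case using unit by (simp add: Jacobi_def)
  next
    case (factor p n)
    then have *: "odd p" "odd n" "coprime a (int p)" "coprime a (int n)" "n > 0"
      by (auto intro: odd_pos)
    then have "sign (affine_mod (p * n) a 0) = Legendre a (int p) * Jacobi a n"
      using factor sign_affine_mod_modulus_mult sign_affine_mod_prime by metis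
    then show ?case using Jacobi_prime_mult factor.hyps * by metis
  qed
  then show ?thesis using sign_affine_mod[OF assms] by metis
qed

subsection \<open>Determinants\<close>

text \<open>Each term of the Leibniz formula takes one entry from every row and every
  column.\<close>

lemma det_scale_rows_cols:
  fixes u v :: "nat \<Rightarrow> 'a :: comm_ring_1"
  shows "det (mat n n (\<lambda>(i, j). u i * v j * A i j))
    = (\<Prod>i<n. u i) * (\<Prod>j<n. v j) * det (mat n n (\<lambda>(i, j). A i j))"
proof -
  have "signof p * (\<Prod>i = 0..<n. mat n n (\<lambda>(i, j). u i * v j * A i j) $$ (i, p i))
      = (\<Prod>i<n. u i) * (\<Prod>j<n. v j) *
        (signof p * (\<Prod>i = 0..<n. mat n n (\<lambda>(i, j). A i j) $$ (i, p i)))"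
    if p: "p permutes {0..<n}" for p
  proof -
    have lt: "p i < n" if "i < n" for i using permutes_in_image[OF p] that by simp
    have "(\<Prod>i = 0..<n. v (p i)) = (\<Prod>i = 0..<n. v i)"
      using prod.permute[OF p, of v] by (simp add: o_def)
    then show ?thesis using lt by (simp add: prod.distrib atLeast0LessThan)
  qed
  then show ?thesis
    by (subst (1 2) det_def'[where n = n]) (auto simp: sum_distrib_left)
qed

lemma det_permute_rows_cols:
  fixes A :: "nat \<Rightarrow> nat \<Rightarrow> 'a :: comm_ring_1"
  assumes p: "p permutes {0..<n}" and r: "r permutes {0..<n}"
  shows "det (mat n n (\<lambda>(i, j). A (p i) (r j)))
    = signof p * signof r * det (mat n n (\<lambda>(i, j). A i j))"
proof -
  have lt: "p i < n" "r i < n" if "i < n" for i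
    using permutes_in_image[OF p] permutes_in_image[OF r] that by simp_all
  define B where "B = mat n n (\<lambda>(j, i). A i j)"
  define C where "C = mat n n (\<lambda>(i, j). A i (r j))"
  have "mat n n (\<lambda>(i, j). A (p i) (r j)) = mat n n (\<lambda>(i, j). C $$ (p i, j))"
    by (rule eq_matI) (auto simp: C_def lt)
  then have "det (mat n n (\<lambda>(i, j). A (p i) (r j))) = signof p * det C"
    using det_permute_rows[OF _ p, of C] by (simp add: C_def)
  \<comment> \<open>Columns are permuted by transposing, permuting rows and transposing
    back.\<close>
  also have "det C = det (transpose_mat C)"
    by (rule det_transpose[symmetric, of _ n]) (simp add: C_def)
  also have "transpose_mat C = mat n n (\<lambda>(i, j). B $$ (r i, j))"
    by (rule eq_matI) (auto simp: C_def B_def lt)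
  also have "det \<dots> = signof r * det B"
    by (rule det_permute_rows[OF _ r]) (simp add: B_def)
  also have "det B = det (transpose_mat B)"
    by (rule det_transpose[symmetric, of _ n]) (simp add: B_def)
  also have "transpose_mat B = mat n n (\<lambda>(i, j). A i j)"
    by (rule eq_matI) (auto simp: B_def)
  finally show ?thesis by (simp add: mult.assoc)
qed

text \<open>Multiplying the bordered matrix B by S on the right, or by T on the left, makes it block
  triangular.\<close>

lemma det_scalar_plus_rank_one:
  fixes c :: "'a :: field"
  shows "c * det (mat n n (\<lambda>(i, j). x i * z j + (if i = j then c else 0)))
    = c ^ n * (c + (\<Sum>i<n. z i * x i))"
proof -
  define X where "X = mat n 1 (\<lambda>(i, j :: nat). x i)"
  define Z where "Z = mat 1 n (\<lambda>(i :: nat, j). z j)"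
  have [simp]: "c \<cdot>\<^sub>m 1\<^sub>m (Suc 0) + Z * X \<in> carrier_mat (Suc 0) (Suc 0)"
    by (rule carrier_matI) (auto simp: X_def Z_def)
  define B where "B = four_block_mat (1\<^sub>m 1) Z (- X) (c \<cdot>\<^sub>m 1\<^sub>m n)"
  have [simp]: "X \<in> carrier_mat n (Suc 0)" "Z \<in> carrier_mat (Suc 0) n"
    by (auto simp: X_def Z_def)
  have B [simp]: "B \<in> carrier_mat (1 + n) (1 + n)"
    unfolding B_def by (rule four_block_carrier_mat) auto
  define S where "S = four_block_mat (1\<^sub>m 1) (- Z) (0\<^sub>m n 1) (1\<^sub>m n)"
  \<comment> \<open>The corner entry \<open>c\<close> makes the upper right block c Z - Z c of
    \<open>T * B\<close> vanish; it is the source of the factor \<open>c\<close> on the left of the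
    claim.\<close>
  define T where "T = four_block_mat (c \<cdot>\<^sub>m 1\<^sub>m 1) (- Z) (0\<^sub>m n 1) (1\<^sub>m n)"
  have ST [simp]: "S \<in> carrier_mat (1 + n) (1 + n)" "T \<in> carrier_mat (1 + n) (1 + n)"
    unfolding S_def T_def by (rule four_block_carrier_mat; auto)+
  have detS: "det S = 1"
    unfolding S_def by (subst det_four_block_mat_lower_left_zero[of _ 1 _ n]) auto
  have detT: "det T = c"
    unfolding T_def by (subst det_four_block_mat_lower_left_zero[of _ 1 _ n]) (auto simp: det_single)
  have "B * S = four_block_mat (1\<^sub>m 1) (0\<^sub>m 1 n) (- X) (X * Z + c \<cdot>\<^sub>m 1\<^sub>m n)"
    unfolding B_def S_def
    by (subst mult_four_block_mat[of _ 1 1 _ n _ n _ _ 1 _ n])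
       (auto intro!: cong_four_block_mat eq_matI simp: X_def Z_def scalar_prod_def
         sum.delta' if_distrib[of "(*) _"] cong: if_cong)
  then have "det (B * S) = det (X * Z + c \<cdot>\<^sub>m 1\<^sub>m n)"
    by (simp, subst det_four_block_mat_upper_right_zero[of _ 1 _ n]) auto
  moreover have "X * Z + c \<cdot>\<^sub>m 1\<^sub>m n = mat n n (\<lambda>(i, j). x i * z j + (if i = j then c else 0))"
    by (rule eq_matI) (auto simp: X_def Z_def scalar_prod_def)
  moreover have "T * B = four_block_mat (c \<cdot>\<^sub>m 1\<^sub>m 1 + Z * X) (0\<^sub>m 1 n) (- X) (c \<cdot>\<^sub>m 1\<^sub>m n)"
    unfolding B_def T_def
    by (subst mult_four_block_mat[of _ 1 1 _ n _ n _ _ 1 _ n])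
       (auto intro!: cong_four_block_mat eq_matI simp: X_def Z_def scalar_prod_def
         sum.delta' if_distrib[of "(*) _"] cong: if_cong)
  then have "det (T * B) = det (c \<cdot>\<^sub>m 1\<^sub>m 1 + Z * X) * c ^ n"
    by (simp, subst det_four_block_mat_upper_right_zero[of _ 1 _ n]) auto
  moreover have "det (c \<cdot>\<^sub>m 1\<^sub>m 1 + Z * X) = c + (\<Sum>i<n. z i * x i)"
    by (subst det_single) (auto simp: X_def Z_def scalar_prod_def atLeast0LessThan)
  ultimately show ?thesis
    using det_mult[OF B ST(1)] det_mult[OF ST(2) B] detS detT by (simp add: mult.commute)
qed

text \<open>\<open>L\<close> replaces each row by the next row minus it, where q times row 0 serves
  as row n. This turns the step matrix into q - 1 times the identity and \<open>w i\<close> into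
  \<open>w (Suc i) - w i\<close>, so \<open>det_scalar_plus_rank_one\<close> applies with c = -(q -
  1).\<close>

lemma det_rank_one_minus_step:
  fixes q :: "'a :: field"
  assumes n: "odd n" and q: "q \<noteq> 1" and w: "w n = q * w 0"
  shows "det (mat n n (\<lambda>(i, l). w i * z l - (if l < i then q else 1))) * (q - 1)
    = (q - 1) ^ (n - 1) * ((\<Sum>i<n. z i * (w (Suc i) - w i)) - (q - 1))"
proof -
  obtain m where m: "n = Suc m" using n by (cases n) auto
  define L where "L = mat n n (\<lambda>(i, j). (if Suc i = j then 1 else 0)
    + (if i = m \<and> j = 0 then q else 0) - (if i = j then 1 else 0))"
  \<comment> \<open>\<open>E\<close> serves to compute \<open>det L\<close>: it has determinant 1,
    and \<open>L * E\<close> is lower triangular with diagonal -1, ..., -1, q - 1, where n - 1 is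
    even.\<close>
  define E where "E = mat n n (\<lambda>(i :: nat, j). if i \<le> j then 1 else (0 :: 'a))"
  define A where "A = mat n n (\<lambda>(i, l). w i * z l - (if l < i then q else 1))"
  have [simp]: "L \<in> carrier_mat n n" "E \<in> carrier_mat n n" "A \<in> carrier_mat n n"
    by (auto simp: L_def E_def A_def)
  have row: "(\<Sum>j = 0..<n. ((if Suc i = j then 1 else 0)
      + (if i = m \<and> j = 0 then q else 0) - (if i = j then 1 else 0)) * f j)
    = (if i = m then q * f 0 else f (Suc i)) - f i" if "i < n" for i and f :: "nat \<Rightarrow> 'a"
  proof -
    have "(\<Sum>j = 0..<n. ((if Suc i = j then 1 else 0)
        + (if i = m \<and> j = 0 then q else 0) - (if i = j then 1 else 0)) * f j)
      = (\<Sum>j = 0..<n. (if Suc i = j then f j else 0)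
        + (if 0 = j then if i = m then q * f j else 0 else 0) - (if i = j then f j else 0))"
      by (rule sum.cong) (auto simp: left_diff_distrib)
    then show ?thesis using that m by (simp add: sum.distrib sum_subtractf sum.delta')
  qed
  have "L * E = mat n n (\<lambda>(i, j). (if i = m then q - (if m \<le> j then 1 else 0)
      else if i = j then -1 else 0))"
    by (rule eq_matI) (auto simp: L_def E_def scalar_prod_def row)
  then have "det (L * E) = (\<Prod>i = 0..<n. if i = m then q - 1 else -1)"
    by (subst det_lower_triangular[where n = n]) (auto simp: m prod_list_diag_prod)
  also have "\<dots> = q - 1"
    using n by (simp add: m prod.If_cases)
  finally have "det L * det E = q - 1" by (simp add: det_mult[of _ n])
  moreover have "det E = 1"
    by (subst det_upper_triangular[where n = n]) (auto simp: E_def prod_list_diag_prod)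
  ultimately have L: "det L = q - 1" by simp
  have "L * A = mat n n (\<lambda>(i, l). (w (Suc i) - w i) * z l + (if i = l then - (q - 1) else 0))"
    (is "_ = ?R")
  proof (rule eq_matI)
    fix i l assume "i < dim_row ?R" "l < dim_col ?R"
    then have il: "i < n" "l < n" by simp_all
    define f where "f = (\<lambda>j. w j * z l - (if l < j then q else 1))"
    have "(L * A) $$ (i, l) = (if i = m then q * f 0 else f (Suc i)) - f i"
      unfolding row[OF il(1), of f, symmetric]
      using il by (simp add: L_def A_def scalar_prod_def f_def)
    \<comment> \<open>For i = m this is where \<open>w n = q * w 0\<close> enters; the step entries
      of row n are all q, since l < n.\<close>
    also have "(if i = m then q * f 0 else f (Suc i)) = f (Suc i)"
      using il w m by (simp add: f_def algebra_simps)
    also have "f (Suc i) - f i = ?R $$ (i, l)"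
      using il by (auto simp: f_def algebra_simps)
    finally show "(L * A) $$ (i, l) = ?R $$ (i, l)" .
  qed (auto simp: L_def A_def)
  then have "- (q - 1) * (det L * det A) = (- (q - 1)) ^ n * (- (q - 1) +
      (\<Sum>i<n. z i * (w (Suc i) - w i)))"
    using det_scalar_plus_rank_one[of "- (q - 1)" n "\<lambda>i. w (Suc i) - w i" z]
    by (simp flip: det_mult[of L n A])
  moreover have "(- (q - 1)) ^ n = - ((q - 1) * (q - 1) ^ (n - 1))"
    using n by (subst power_minus_odd) (simp_all add: m)
  ultimately have "- (q - 1) * ((q - 1) * det A) = - ((q - 1) * (q - 1) ^ (n - 1)) *
      (- (q - 1) + (\<Sum>i<n. z i * (w (Suc i) - w i)))"
    unfolding L by (simp only:)
  moreover have "r * (D * r) = r * (p * (S - r))"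
    if "- r * (r * D) = - (r * p) * (- r + S)" for r D p S :: 'a
    using that by (simp add: algebra_simps)
  ultimately have "(q - 1) * (det A * (q - 1)) = (q - 1) * ((q - 1) ^ (n - 1) *
      ((\<Sum>i<n. z i * (w (Suc i) - w i)) - (q - 1)))"
    by blast
  then show ?thesis using q by (simp add: A_def)
qed

subsection \<open>Common factors with the modulus\<close>

lemma Jacobi_eq_0:
  assumes "n > 0" "\<not> coprime a (int n)"
  shows "Jacobi a n = 0"
proof -
  obtain d where d: "d dvd a" "d dvd int n" "\<not> is_unit d"
    using assms(2) by (rule not_coprimeE)
  moreover have "nat \<bar>d\<bar> \<noteq> 1" using d(3) by (auto simp: nat_eq_iff)
  then obtain p where p: "prime p" "p dvd nat \<bar>d\<bar>" using prime_factor_nat by blast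
  have "int p dvd int (nat \<bar>d\<bar>)" using p(2) of_nat_dvd_iff by blast
  then have "int p dvd d" by simp
  ultimately have "int p dvd a" "p dvd n" by (auto dest: dvd_trans simp flip: int_dvd_int_iff)
  then have "Legendre a (int p) = 0" "p \<in> prime_factors n" "multiplicity p n > 0"
    using p(1) assms(1)
    by (auto simp: Legendre_def cong_0_iff prime_factors_dvd prime_multiplicity_gt_zero_iff)
  then show ?thesis unfolding Jacobi_def by (intro prod_zero) auto
qed

lemma ceiling_add_period:
  assumes "n > 0"
  shows "\<lceil>real_of_int (x + int n * s) / real n\<rceil> = \<lceil>real_of_int x / real n\<rceil> + s"
proof -
  have "real_of_int (x + int n * s) / real n = real_of_int x / real n + real_of_int s"
    using assms by (simp add: field_simps)
  then show ?thesis by simp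
qed

text \<open>With d = gcd \<alpha> n \<ge> 3 and r = q powi (\<alpha> div d), the columns 0, n div d and 2 * (n div d)
  are, up to a common factor, 1 - X, 1 - r * X and 1 - r * r * X for one vector X.\<close>

lemma det_qint_ceiling_eq_0:
  assumes "odd n" "q \<noteq> 0" "\<not> coprime \<alpha> (int n)"
  shows "det (mat n n (\<lambda>(j, k). qint q \<lceil>real_of_int (f j + \<alpha> * (int k + 1)) / real n\<rceil>)) = 0"
    (is "det ?M = 0")
proof -
  have n: "n > 0" using assms(1) by (rule odd_pos)
  define d where "d = gcd \<alpha> (int n)"
  obtain s e where s: "\<alpha> = d * s" and e: "int n = d * e"
    unfolding d_def by (meson dvdE gcd_dvd1 gcd_dvd2)
  have "d > 0" "d \<noteq> 1" using n assms(3) by (auto simp: d_def coprime_iff_gcd_eq_1)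
  moreover have "odd d" using assms(1) e by (metis even_mult_iff even_of_nat)
  \<comment> \<open>Oddness excludes d = 2, which leaves room for the three columns 0, k and 2 *
    k.\<close>
  ultimately have d: "d \<ge> 3" by presburger
  have "e > 0" using e n \<open>d > 0\<close> by (metis of_nat_0_less_iff zero_less_mult_pos)
  then obtain k where k: "e = int k" "k > 0" by (metis zero_less_imp_eq_int)
  have "3 * e \<le> int n" unfolding e using d \<open>e > 0\<close> by (intro mult_right_mono) auto
  then have kn: "2 * k < n" using k by linarith
  define r where "r = q powi s"
  \<comment> \<open>The entries are the coefficients of (T - 1) (T - r), which annihilates every
    linear combination of the sequences 1 and \<open>r ^ t\<close>.\<close>
  define v where "v = vec n (\<lambda>i. (if 0 = i then r else 0) + (if k = i then - (1 + r) else 0)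
    + (if 2 * k = i then 1 else 0))"
  have period: "f j + \<alpha> * (int (t * k) + 1) = f j + \<alpha> + int n * (int t * s)" for j t
    by (simp add: s e k algebra_simps)
  have "?M *\<^sub>v v = 0\<^sub>v n"
  proof (rule eq_vecI)
    fix j assume "j < dim_vec (0\<^sub>v n :: complex vec)"
    then have j: "j < n" by simp
    define g where "g = (\<lambda>i. qint q \<lceil>real_of_int (f j + \<alpha> * (int i + 1)) / real n\<rceil>)"
    define x where "x = q powi \<lceil>real_of_int (f j + \<alpha>) / real n\<rceil>"
    have g: "g (t * k) = (1 - x * r ^ t) / (1 - q)" for t
      unfolding g_def period ceiling_add_period[OF n] qint_def
      using assms(2) by (simp add: x_def r_def power_int_add power_int_mult mult.commute)
    have "(?M *\<^sub>v v) $ j = (\<Sum>i = 0..<n. g i * ((if 0 = i then r else 0)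
        + (if k = i then - (1 + r) else 0) + (if 2 * k = i then 1 else 0)))"
      using j by (simp add: v_def scalar_prod_def g_def)
    also have "\<dots> = (\<Sum>i = 0..<n. (if 0 = i then g i * r else 0)
        + (if k = i then g i * - (1 + r) else 0) + (if 2 * k = i then g i else 0))"
      by (rule sum.cong) (auto simp: algebra_simps)
    also have "\<dots> = g (0 * k) * r + g (1 * k) * - (1 + r) + g (2 * k)"
      using n kn by (simp add: sum.distrib sum.delta')
    also have "\<dots> = 0"
      unfolding g by (simp add: field_simps power2_eq_square)
        (simp add: algebra_simps add_divide_distrib diff_divide_distrib)
    finally show "(?M *\<^sub>v v) $ j = 0\<^sub>v n $ j" using j by simp
  qed auto
  moreover have "v \<in> carrier_vec n" by (simp add: v_def)
  moreover have "v \<noteq> 0\<^sub>v n"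
  proof
    assume "v = 0\<^sub>v n"
    then have "v $ (2 * k) = 0" using kn by simp
    then show False using kn k by (simp add: v_def)
  qed
  ultimately show ?thesis
    by (subst det_0_iff_vec_prod_zero[of _ n]) auto
qed

subsection \<open>The coprime case\<close>

lemma linear_cong_unique:
  assumes "coprime \<alpha> (int n)" "1 \<le> x" "x \<le> int n" "1 \<le> y" "y \<le> int n"
    "[\<alpha> * x = \<alpha> * y] (mod int n)"
  shows "x = y"
proof -
  have "[x = y] (mod int n)" using assms by (simp add: cong_mult_lcancel)
  \<comment> \<open>Subtracting 1 moves the range 1..n to 0..n-1, where congruent numbers are
    equal.\<close>
  then have "[x - 1 = y - 1] (mod int n)" by (rule cong_diff) simp
  then show ?thesis using assms by (simp add: cong_def)
qed

text \<open>\<open>R\<close> inverts multiplication by \<alpha> modulo \<open>n\<close>, and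
  \<open>u\<close> records the remaining multiple of \<open>n\<close>; these multiples become
  exponents of q.\<close>

lemma linear_cong_solution:
  assumes "coprime \<alpha> (int n)" "n > 0"
  obtains R u :: "int \<Rightarrow> int"
  where "\<And>m. 1 \<le> R m" "\<And>m. R m \<le> int n" "\<And>m. \<alpha> * R m = m + int n * u m"
proof -
  have "\<exists>x y. 1 \<le> x \<and> x \<le> int n \<and> \<alpha> * x = m + int n * y" for m
  proof -
    obtain \<beta> where \<beta>: "[\<alpha> * \<beta> = 1] (mod int n)"
      using assms(1) cong_solve_coprime_int by blast
    define x where "x = (\<beta> * m - 1) mod int n + 1"
    have "[\<alpha> * x = \<alpha> * (\<beta> * m - 1 + 1)] (mod int n)"
      unfolding x_def by (intro cong_mult cong_add) auto
    also have "\<alpha> * (\<beta> * m - 1 + 1) = (\<alpha> * \<beta>) * m" by simp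
    also have "[(\<alpha> * \<beta>) * m = 1 * m] (mod int n)"
      using \<beta> by (intro cong_mult) auto
    finally have "[m = \<alpha> * x] (mod int n)" by (simp add: cong_sym)
    then obtain y where "\<alpha> * x = m + int n * y" by (auto simp: cong_iff_lin)
    moreover have "1 \<le> x" "x \<le> int n"
      using assms(2) pos_mod_bound[of "int n" "\<beta> * m - 1"] pos_mod_sign[of "int n" "\<beta> * m - 1"]
      unfolding x_def by linarith+
    ultimately show ?thesis by blast
  qed
  then show ?thesis using that by metis
qed


text \<open>Modulo n, the pairs (x, y) with a x + 1 = (a + 1) y are the pairs with a x = (a + 1) y
  translated by (1, 1). With representatives in 1..n, only the translate of (n, n) wraps around.\<close>

lemma sum_wraparound:
  fixes q :: complex
  assumes n: "n > 0" and q: "q \<noteq> 0"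
    and a: "coprime a (int n)" and b: "coprime (a + 1) (int n)"
    and J: "\<And>m. 1 \<le> J m" "\<And>m. J m \<le> int n" "\<And>m. (a + 1) * J m = m + int n * u m"
    and K: "\<And>m. 1 \<le> K m" "\<And>m. K m \<le> int n" "\<And>m. a * K m = m + int n * v m"
  shows "(\<Sum>i<n. q powi v (int i + 1) * (q powi (- u (int (Suc i) + 1)) - q powi (- u (int i + 1))))
    = 1 - 1 / q"
proof -
  \<comment> \<open>n (v m - u m) = a K m - (a + 1) J m, so \<open>t\<close> has period n because
    \<open>J\<close> and \<open>K\<close> do.\<close>
  define t where "t = (\<lambda>m. q powi (v m - u m))"
  have Jc: "[(a + 1) * J m = m] (mod int n)" and Kc: "[a * K m = m] (mod int n)" for m
    unfolding J(3) K(3) by (simp_all add: cong_def)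
  have Junique: "J m = x" if "1 \<le> x" "x \<le> int n" "[(a + 1) * x = m] (mod int n)" for m x
    by (rule linear_cong_unique[OF b J(1,2) that(1,2)]) (meson Jc that(3) cong_sym cong_trans)
  have Kunique: "K m = x" if "1 \<le> x" "x \<le> int n" "[a * x = m] (mod int n)" for m x
    by (rule linear_cong_unique[OF a K(1,2) that(1,2)]) (meson Kc that(3) cong_sym cong_trans)
  have cancel: "x = y" if "int n * x = int n * y" for x y using that n by simp
  have t_cong: "t m = t m'" if "[m = m'] (mod int n)" for m m'
  proof -
    have "J m = J m'" "K m = K m'"
      using Junique[OF J(1,2)] Kunique[OF K(1,2)] Jc Kc that by (meson cong_sym cong_trans)+
    then have "int n * (v m - u m) = int n * (v m' - u m')"
      using J(3)[of m] J(3)[of m'] K(3)[of m] K(3)[of m'] by (simp add: right_diff_distrib)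
    then show ?thesis unfolding t_def using cancel by metis
  qed
  \<comment> \<open>The pair (K m, J (m + 1)) solves a x + 1 = (a + 1) y modulo n. Its translate by
    (-1, -1) is (K (m - a), J (m - a)), except for m = a modulo n: there (1, 1) is paired with (n,
    n), and the exponents are 0 and -1.\<close>
  have step: "q powi (v m - u (m + 1)) = t (m - a) + (if [m = a] (mod int n) then 1 - 1 / q else 0)"
    for m
  proof (cases "[m = a] (mod int n)")
    case True
    have "K m = 1" using n True by (intro Kunique) (auto simp: cong_sym)
    moreover have "J (m + 1) = 1"
      using n cong_add[OF cong_sym[OF True] cong_refl[of 1]] by (intro Junique) auto
    ultimately have "v m = u (m + 1)" using J(3)[of "m + 1"] K(3)[of m] n by auto
    have "int n dvd m - a" using True by (simp add: cong_iff_dvd_diff)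
    then have "[x * int n = m - a] (mod int n)" for x
      unfolding cong_iff_dvd_diff using dvd_diff[OF dvd_triv_right] by blast
    then have "K (m - a) = int n" "J (m - a) = int n"
      using n Kunique[of "int n"] Junique[of "int n"] by simp_all
    then have "v (m - a) - u (m - a) = -1"
      using J(3)[of "m - a"] K(3)[of "m - a"] by - (rule cancel, simp add: algebra_simps)
    then show ?thesis
      using True \<open>v m = u (m + 1)\<close> by (simp add: t_def power_int_minus inverse_eq_divide)
  next
    case False
    have "K m \<noteq> 1" using False Kc[of m] by (auto simp: cong_sym_eq)
    have "J (m + 1) \<noteq> 1"
    proof
      assume "J (m + 1) = 1"
      then have "[a + 1 = m + 1] (mod int n)" using Jc[of "m + 1"] by simp
      then show False using False by (simp add: cong_add_rcancel cong_sym_eq)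
    qed
    have "[a * K m - a = m - a] (mod int n)" by (intro cong_diff Kc) simp
    then have "K (m - a) = K m - 1"
      using K(1,2)[of m] \<open>K m \<noteq> 1\<close> by (intro Kunique) (auto simp: algebra_simps)
    then have "a * K m - a = m - a + int n * v (m - a)"
      using K(3)[of "m - a"] by (simp add: right_diff_distrib)
    then have "int n * v (m - a) = int n * v m" using K(3)[of m] by linarith
    then have "v (m - a) = v m" by (rule cancel)
    have "[(a + 1) * J (m + 1) - (a + 1) = m + 1 - (a + 1)] (mod int n)" by (intro cong_diff Jc) simp
    then have "J (m - a) = J (m + 1) - 1"
      using J(1,2)[of "m + 1"] \<open>J (m + 1) \<noteq> 1\<close> by (intro Junique) (auto simp: algebra_simps)
    then have "(a + 1) * J (m + 1) - (a + 1) = m - a + int n * u (m - a)"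
      using J(3)[of "m - a"] by (simp add: right_diff_distrib)
    then have "int n * u (m - a) = int n * u (m + 1)" using J(3)[of "m + 1"] by linarith
    then have "u (m - a) = u (m + 1)" by (rule cancel)
    then show ?thesis using False \<open>v (m - a) = v m\<close> by (simp add: t_def)
  qed
  have "(\<Sum>i<n. q powi v (int i + 1) * (q powi (- u (int (Suc i) + 1)) - q powi (- u (int i + 1))))
      = (\<Sum>i<n. q powi (v (int i + 1) - u (int i + 1 + 1)) - t (int i + 1))"
    using q by (intro sum.cong refl)
      (simp add: t_def power_int_diff power_int_minus field_simps)
  also have "\<dots> = (\<Sum>i<n. t (int i + 1 - a)) + (\<Sum>i<n. if [int i + 1 = a] (mod int n) then 1 - 1 / q else 0)
      - (\<Sum>i<n. t (int i + 1))"
    unfolding step by (simp add: sum.distrib sum_subtractf)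
  \<comment> \<open>By periodicity, translating the argument by -a only permutes the summands, so
    the two sums of \<open>t\<close> cancel.\<close>
  also have "(\<Sum>i<n. t (int i + 1)) = (\<Sum>i<n. t (int (affine_mod n 1 (- a) i) + 1))"
    using sum.permute[OF affine_mod_permutes[of 1 n "- a"], of "\<lambda>i. t (int i + 1)"]
    by (simp add: o_def atLeast0LessThan)
  also have "\<dots> = (\<Sum>i<n. t (int i + 1 - a))"
  proof (intro sum.cong refl t_cong)
    fix i assume "i \<in> {..<n}"
    then have "[int (affine_mod n 1 (- a) i) + 1 = int i - a + 1] (mod int n)"
      by (intro cong_add) (auto simp: int_affine_mod)
    then show "[int (affine_mod n 1 (- a) i) + 1 = int i + 1 - a] (mod int n)"
      by (simp add: algebra_simps)
  qed
  \<comment> \<open>Exactly one i < n satisfies i + 1 = a modulo n, so the excess 1 - 1 / q occurs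
    once.\<close>
  also have "(\<Sum>i<n. if [int i + 1 = a] (mod int n) then 1 - 1 / q else 0)
      = (\<Sum>i<n. if i = nat ((a - 1) mod int n) then 1 - 1 / q else 0)"
  proof (intro sum.cong refl if_cong)
    fix i assume i: "i \<in> {..<n}"
    have "[int i + 1 = a] (mod int n) \<longleftrightarrow> [int i = a - 1] (mod int n)"
      using cong_add_rcancel[of "int i" 1 "a - 1" "int n"] by simp
    also have "\<dots> \<longleftrightarrow> i = nat ((a - 1) mod int n)"
      using i n by (auto simp: cong_def nat_eq_iff)
    finally show "[int i + 1 = a] (mod int n) \<longleftrightarrow> i = nat ((a - 1) mod int n)" .
  qed
  also have "\<dots> = 1 - 1 / q"
    using n by (simp add: sum.delta nat_less_iff)
  finally show ?thesis by simp
qed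

section \<open>Evaluation of the determinant\<close>

lemma prod_powi:
  fixes q :: complex
  assumes "q \<noteq> 0"
  shows "(\<Prod>i\<in>A. q powi f i) = q powi (\<Sum>i\<in>A. f i)"
  using assms by (induction A rule: infinite_finite_induct) (auto simp: power_int_add)

text \<open>Undoing the permutations and removing row factors q^u / (1 - q) and column factors
  q^(-v) leaves \<open>M\<close>, of determinant (1 - q)^n / q; the removed powers of q multiply to
  q^((n+1)/2).\<close>

lemma det_qint_ceiling_coprime:
  fixes a :: int and n :: nat and q :: complex
  assumes "odd n" "q \<noteq> 0" "q \<noteq> 1" and a: "coprime a (int n)" and b: "coprime (a + 1) (int n)"
  shows "det (mat n n (\<lambda>(j, k).
            qint q \<lceil>real_of_int ((a + 1) * (int j + 1) - a * (int k + 1)) / real n\<rceil>))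
         = of_int (Jacobi (a * (a + 1)) n) * q ^ ((n - 1) div 2)"
proof -
  have n: "n > 0" using assms(1) by (rule odd_pos)
  obtain J u where J: "\<And>m. 1 \<le> J m" "\<And>m. J m \<le> int n" "\<And>m. (a + 1) * J m = m + int n * u m"
    using linear_cong_solution[OF b n] by metis
  obtain K v where K: "\<And>m. 1 \<le> K m" "\<And>m. K m \<le> int n" "\<And>m. a * K m = m + int n * v m"
    using linear_cong_solution[OF a n] by metis
  \<comment> \<open>Indices start at 0: the constants a and a - 1 make \<open>\<pi> j + 1\<close>
    and \<open>\<rho> k + 1\<close> the representatives in 1..n of (a + 1) (j + 1) and a (k +
    1).\<close>
  define \<pi> where "\<pi> = affine_mod n (a + 1) a"
  define \<rho> where "\<rho> = affine_mod n a (a - 1)"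
  have perm: "\<pi> permutes {0..<n}" "\<rho> permutes {0..<n}"
    unfolding \<pi>_def \<rho>_def using a b by (auto intro: affine_mod_permutes)
  have row: "(a + 1) * (int j + 1) = int (\<pi> j) + 1 + int n * u (int (\<pi> j) + 1)" if "j < n" for j
  proof -
    have "[(a + 1) * J (int (\<pi> j) + 1) = int (\<pi> j) + 1] (mod int n)"
      unfolding J(3) by (simp add: cong_def)
    also have "[int (\<pi> j) + 1 = ((a + 1) * int j + a) + 1] (mod int n)"
      unfolding \<pi>_def int_affine_mod[OF that] by (intro cong_add) auto
    also have "((a + 1) * int j + a) + 1 = (a + 1) * (int j + 1)" by (simp add: algebra_simps)
    finally have "J (int (\<pi> j) + 1) = int j + 1"
      using J(1,2) that by (intro linear_cong_unique[OF b]) auto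
    then show ?thesis using J(3)[of "int (\<pi> j) + 1"] by simp
  qed
  have col: "a * (int k + 1) = int (\<rho> k) + 1 + int n * v (int (\<rho> k) + 1)" if "k < n" for k
  proof -
    have "[a * K (int (\<rho> k) + 1) = int (\<rho> k) + 1] (mod int n)"
      unfolding K(3) by (simp add: cong_def)
    also have "[int (\<rho> k) + 1 = (a * int k + (a - 1)) + 1] (mod int n)"
      unfolding \<rho>_def int_affine_mod[OF that] by (intro cong_add) auto
    also have "(a * int k + (a - 1)) + 1 = a * (int k + 1)" by (simp add: algebra_simps)
    finally have "K (int (\<rho> k) + 1) = int k + 1"
      using K(1,2) that by (intro linear_cong_unique[OF a]) auto
    then show ?thesis using K(3)[of "int (\<rho> k) + 1"] by simp
  qed
  define w where "w = (\<lambda>i. q powi (- u (int i + 1)))"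
  define z where "z = (\<lambda>l. q powi v (int l + 1))"
  define M where "M = (\<lambda>i l. w i * z l - (if l < i then q else 1))"
  have lt: "\<pi> i < n" "\<rho> i < n" if "i < n" for i using that by (auto simp: \<pi>_def \<rho>_def)
  have entry: "qint q \<lceil>real_of_int ((a + 1) * (int j + 1) - a * (int k + 1)) / real n\<rceil>
      = (q powi u (int (\<pi> j) + 1) / (1 - q)) * q powi (- v (int (\<rho> k) + 1)) * M (\<pi> j) (\<rho> k)"
    if "j < n" "k < n" for j k
  proof -
    let ?u = "u (int (\<pi> j) + 1)" and ?v = "v (int (\<rho> k) + 1)"
    \<comment> \<open>The difference of two residues lies strictly between -n and n, so the ceiling
      is 1 if it is positive and 0 otherwise.\<close>
    have "\<lceil>real_of_int (int (\<pi> j) - int (\<rho> k)) / real n\<rceil> = (if \<rho> k < \<pi> j then 1 else 0)"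
      using lt[OF that(1)] lt[OF that(2)] by (auto simp: ceiling_eq_iff field_simps)
    moreover have "(a + 1) * (int j + 1) - a * (int k + 1)
        = int (\<pi> j) - int (\<rho> k) + int n * (?u - ?v)"
      unfolding row[OF that(1)] col[OF that(2)] by (simp add: algebra_simps)
    ultimately have "\<lceil>real_of_int ((a + 1) * (int j + 1) - a * (int k + 1)) / real n\<rceil>
        = (if \<rho> k < \<pi> j then 1 else 0) + (?u - ?v)"
      by (simp only: ceiling_add_period[OF n])
    then have "qint q \<lceil>real_of_int ((a + 1) * (int j + 1) - a * (int k + 1)) / real n\<rceil>
        = (1 - q powi ((if \<rho> k < \<pi> j then 1 else 0) + (?u - ?v))) / (1 - q)"
      unfolding qint_def by (simp only:)
    moreover have "q powi ((if \<rho> k < \<pi> j then 1 else 0) + (?u - ?v))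
        = q powi ?u * q powi (- ?v) * (if \<rho> k < \<pi> j then q else 1)"
      using assms(2) by (simp add: power_int_add power_int_diff power_int_minus field_simps)
    moreover have "q powi ?u * w (\<pi> j) = 1" "q powi (- ?v) * z (\<rho> k) = 1"
      using assms(2) by (simp_all add: w_def z_def flip: power_int_add)
    then have "q powi ?u * q powi (- ?v) * (w (\<pi> j) * z (\<rho> k)) = 1"
      by (metis mult.assoc mult.left_commute mult_1)
    then have "q powi ?u * q powi (- ?v) * M (\<pi> j) (\<rho> k)
        = 1 - q powi ?u * q powi (- ?v) * (if \<rho> k < \<pi> j then q else 1)"
      unfolding M_def by (simp only: right_diff_distrib)
    ultimately show ?thesis by (simp only: times_divide_eq_left)
  qed
  \<comment> \<open>\<open>\<pi>\<close> and \<open>\<rho>\<close> preserve the sum of the indices,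
    so subtracting the summed column identities from the summed row identities shows that n times
    the exponent sum is 1 + ... + n.\<close>
  have sums: "(\<Sum>j<n. u (int (\<pi> j) + 1)) + (\<Sum>k<n. - v (int (\<rho> k) + 1)) = (int n + 1) div 2"
  proof -
    have "(\<Sum>j<n. int (\<pi> j)) = (\<Sum>j<n. int j)" "(\<Sum>k<n. int (\<rho> k)) = (\<Sum>k<n. int k)"
      using sum.permute[OF perm(1), of int] sum.permute[OF perm(2), of int]
      by (simp_all add: o_def atLeast0LessThan)
    moreover have "(\<Sum>j<n. (a + 1) * (int j + 1))
        = (\<Sum>j<n. int (\<pi> j)) + int n + int n * (\<Sum>j<n. u (int (\<pi> j) + 1))"
      using row by (simp add: sum.distrib sum_distrib_left)
    moreover have "(\<Sum>k<n. a * (int k + 1))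
        = (\<Sum>k<n. int (\<rho> k)) + int n + int n * (\<Sum>k<n. v (int (\<rho> k) + 1))"
      using col by (simp add: sum.distrib sum_distrib_left)
    moreover have "(\<Sum>j<n. (a + 1) * (int j + 1)) - (\<Sum>k<n. a * (int k + 1)) = (\<Sum>j<n. int j + 1)"
      by (simp add: algebra_simps flip: sum_subtractf)
    ultimately have "int n * ((\<Sum>j<n. u (int (\<pi> j) + 1)) - (\<Sum>k<n. v (int (\<rho> k) + 1)))
        = (\<Sum>j<n. int j + 1)"
      by (simp add: right_diff_distrib)
    moreover have "2 * (\<Sum>j<n. int j + 1) = int n * (int n + 1)"
      by (induction n) (auto simp: algebra_simps)
    ultimately have "int n * (2 * ((\<Sum>j<n. u (int (\<pi> j) + 1)) - (\<Sum>k<n. v (int (\<rho> k) + 1))))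
        = int n * (int n + 1)"
      by (metis mult.left_commute)
    then have "2 * ((\<Sum>j<n. u (int (\<pi> j) + 1)) - (\<Sum>k<n. v (int (\<rho> k) + 1))) = int n + 1"
      using n by simp
    then show ?thesis by (simp add: sum_negf)
  qed
  have "det (mat n n (\<lambda>(i, l). M i l)) * (q - 1) = (q - 1) ^ (n - 1) * ((1 - 1 / q) - (q - 1))"
  proof -
    \<comment> \<open>As n + 1 is congruent to 1, the representative is the same and the quotient
      drops by one, which gives w n = q * w 0.\<close>
    have "J (int n + 1) = J 1"
    proof (rule linear_cong_unique[OF b J(1,2) J(1,2)])
      show "[(a + 1) * J (int n + 1) = (a + 1) * J 1] (mod int n)"
        unfolding J(3) by (simp add: cong_def)
    qed
    then have "int n * u (int n + 1) = int n * (u 1 - 1)"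
      using J(3)[of "int n + 1"] J(3)[of 1] by (simp add: right_diff_distrib)
    then have "u (int n + 1) = u 1 - 1" using n by simp
    then have "- u (int n + 1) = 1 + - u 1" by simp
    then have "w n = q * w 0"
      using assms(2) power_int_add[of q 1 "- u 1"] by (simp only: w_def) simp
    then show ?thesis
      using det_rank_one_minus_step[OF assms(1,3), of w z] sum_wraparound[OF n assms(2) a b J K]
      unfolding M_def by (simp add: w_def z_def)
  qed
  also have "\<dots> = (1 - q) ^ n / q * (q - 1)"
  proof -
    have "(1 - q) ^ n = - ((q - 1) ^ n)"
      using assms(1) by (metis minus_diff_eq power_minus_odd)
    also have "(q - 1) ^ n = (q - 1) * (q - 1) ^ (n - 1)"
      using n by (simp add: power_eq_if)
    finally have "(1 - q) ^ n = - ((q - 1) * (q - 1) ^ (n - 1))" .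
    moreover have "(1 - 1 / q) - (q - 1) = - ((q - 1) * (q - 1)) / q"
      using assms(2) by (simp add: field_simps)
    ultimately show ?thesis by simp
  qed
  finally have detM: "det (mat n n (\<lambda>(i, l). M i l)) = (1 - q) ^ n / q"
    using assms(3) by (metis mult_right_cancel right_minus_eq)
  have "mat n n (\<lambda>(j, k).
            qint q \<lceil>real_of_int ((a + 1) * (int j + 1) - a * (int k + 1)) / real n\<rceil>)
      = mat n n (\<lambda>(j, k). (q powi u (int (\<pi> j) + 1) / (1 - q)) * q powi (- v (int (\<rho> k) + 1))
          * M (\<pi> j) (\<rho> k))"
    by (rule eq_matI) (simp_all only: index_mat dim_row_mat dim_col_mat entry split)
  then have "det (mat n n (\<lambda>(j, k).
            qint q \<lceil>real_of_int ((a + 1) * (int j + 1) - a * (int k + 1)) / real n\<rceil>))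
      = (\<Prod>j<n. q powi u (int (\<pi> j) + 1) / (1 - q)) * (\<Prod>k<n. q powi (- v (int (\<rho> k) + 1)))
        * (signof \<pi> * signof \<rho> * ((1 - q) ^ n / q))"
    by (simp only: det_scale_rows_cols det_permute_rows_cols[OF perm, of M] detM)
  also have "(\<Prod>j<n. q powi u (int (\<pi> j) + 1) / (1 - q)) * (\<Prod>k<n. q powi (- v (int (\<rho> k) + 1)))
      = q powi ((int n + 1) div 2) / (1 - q) ^ n"
    unfolding prod_dividef prod_powi[OF assms(2)] sums[symmetric]
    using assms(2) by (simp add: power_int_add)
  \<comment> \<open>The extra factor q cancels the 1 / q in the determinant of
    \<open>M\<close>.\<close>
  also have "(int n + 1) div 2 = int ((n - 1) div 2) + 1"
    using assms(1) by (auto elim!: oddE)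
  also have "sign \<pi> * sign \<rho> = Jacobi (a * (a + 1)) n"
  proof -
    have "sign \<pi> * sign \<rho> = sign (affine_mod n a 0) * sign (affine_mod n (a + 1) 0)"
      unfolding \<pi>_def \<rho>_def by (metis a assms(1) b mult.commute sign_affine_mod)
    also have "\<dots> = sign (affine_mod n (a * (a + 1)) 0)"
      by (rule sign_affine_mod_mult[OF a b, symmetric])
    also have "\<dots> = Jacobi (a * (a + 1)) n"
      using a b by (intro zolotarev[OF assms(1)]) simp
    finally show ?thesis .
  qed
  then have "signof \<pi> * signof \<rho> = (of_int (Jacobi (a * (a + 1)) n) :: complex)"
    by (metis of_int_mult)
  finally show ?thesis
    using assms(2,3) by (simp add: power_int_add)
qed

theorem theorem1p2:
  fixes a :: int and n :: nat and q :: complex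
  assumes "odd n" and "n > 0" and "q \<noteq> 0" and "q \<noteq> 1"
  shows "det (mat n n (\<lambda>(j, k).
            qint q \<lceil>real_of_int ((a + 1) * (int j + 1) - a * (int k + 1)) / real n\<rceil>))
         = of_int (Jacobi (a * (a + 1)) n) * q ^ ((n - 1) div 2)"
proof (cases "coprime a (int n) \<and> coprime (a + 1) (int n)")
  case True
  then show ?thesis using det_qint_ceiling_coprime assms by blast
next
  case False
  let ?f = "\<lambda>j k. qint q \<lceil>real_of_int ((a + 1) * (int j + 1) - a * (int k + 1)) / real n\<rceil>"
  have "det (mat n n (\<lambda>(j, k). ?f j k)) = 0"
  proof (cases "coprime a (int n)")
    case True
    then have "\<not> coprime (a + 1) (int n)" using False by simp
    \<comment> \<open>Here the matrix is transposed, so that a + 1 is the coefficient of the column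
      index.\<close>
    from det_qint_ceiling_eq_0[OF assms(1,3) this, of "\<lambda>k. - a * (int k + 1)"]
    have "det (mat n n (\<lambda>(k, j). ?f j k)) = 0"
      by (simp only: minus_mult_left[symmetric] uminus_add_conv_diff)
    moreover have "transpose_mat (mat n n (\<lambda>(j, k). ?f j k)) = mat n n (\<lambda>(k, j). ?f j k)"
      by (rule eq_matI) auto
    ultimately show ?thesis
      using det_transpose[of "mat n n (\<lambda>(j, k). ?f j k)" n] by simp
  next
    case False
    then have "\<not> coprime (- a) (int n)" by simp
    from det_qint_ceiling_eq_0[OF assms(1,3) this, of "\<lambda>j. (a + 1) * (int j + 1)"]
    show ?thesis by (simp only: minus_mult_left[symmetric] add_uminus_conv_diff)
  qed
  moreover have "Jacobi (a * (a + 1)) n = 0"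
    using False assms(2) by (intro Jacobi_eq_0) auto
  ultimately show ?thesis by simp
qed

end
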